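(* Let $\mathscr{Y}$ be a mixed graph that is a $\gamma$-monograph and such that $\Gamma(\mathscr{Y})=L(\mathscr{T})$ for some tree $\mathscr{T}$. Then $\mathscr{Y}=L_\gamma(\mathscr{X})$ for some mixed graph $\mathscr{X}$ with $\Gamma(\mathscr{X})=\mathscr{T}$.
   Context: $\gamma=e^{2\pi i/3}$. A mixed graph is obtained from a finite simple undirected graph by orienting some (possibly none or all) of its edges into arcs; the unoriented edges are called digons. $\Gamma(\mathscr{D})$ denotes the underlying undirected graph of $\mathscr{D}$; a mixed orientation of an undirected graph $\mathscr{G}$ is a mixed graph with underlying graph $\mathscr{G}$. $L(\mathscr{G})$ is the ordinary undirected line graph. $\gamma$-Hermitian adjacency matrix $H=H_\gamma(\mathscr{D})$: the entry at $(u,v)$ is $1$ if $uv$ is a digon, $\gamma$ if there is an arc from $u$ to $v$, $\overline\gamma$ if there is an arc from $v$ to $u$, and $0$ otherwise. The value of a walk $W=v_1v_2\ldots v_k$ (a walk in $\Gamma(\mathscr{D})$) is $h_\gamma(W)=H_{v_1,v_2}H_{v_2,v_3}\cdots H_{v_{k-1},v_k}$. $\mathscr{D}$ is a $\gamma$-monograph if $h_\gamma(\vec C)=1$ for every cycle $C$ of $\Gamma(\mathscr{D})$, where $\vec C$ is an arbitrary closed traversal walk on $C$. $\gamma$-line graph $L_\gamma(\mathscr{D})$: the mixed orientation of $L(\Gamma(\mathscr{D}))$ given as follows. For distinct edges $e,f$ sharing a vertex $v$: if $e$ is an arc with head $v$ and $f$ is an arc with tail $v$, there is an arc from $e$ to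 $f$; if $e,f$ are both arcs with head $v$, or both arcs with tail $v$, or both digons, then $ef$ is a digon; if $e$ is an arc with head $v$ and $f$ is a digon, there is an arc from $f$ to $e$; if $e$ is an arc with tail $v$ and $f$ is a digon, there is an arc from $e$ to $f$. *)

theory Defs
  imports Complex_Main
begin

record 'a ugraph =
  verts :: "'a set"
  edges :: "'a set set"

definition simple_graph :: "'a ugraph \<Rightarrow> bool" where
  "simple_graph G \<longleftrightarrow> finite (verts G) \<and> (\<forall>e\<in>edges G. e \<subseteq> verts G \<and> card e = 2)"

definition walk :: "'a ugraph \<Rightarrow> 'a list \<Rightarrow> bool" where
  "walk G W \<longleftrightarrow> W \<noteq> [] \<and> set W \<subseteq> verts G \<and> successively (\<lambda>u v. {u, v} \<in> edges G) W"

definition connected_graph :: "'a ugraph \<Rightarrow> bool" where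
  "connected_graph G \<longleftrightarrow> verts G \<noteq> {} \<and>
     (\<forall>u\<in>verts G. \<forall>v\<in>verts G. \<exists>W. walk G W \<and> hd W = u \<and> last W = v)"

text \<open>
  A cycle is represented by its closed traversal walks \<open>[v\<^sub>1, \<dots>, v\<^sub>k, v\<^sub>1]\<close> with \<open>k \<ge> 3\<close>
  distinct vertices; every starting vertex and both directions give such a walk.
\<close>

definition cycle_walk :: "'a ugraph \<Rightarrow> 'a list \<Rightarrow> bool" where
  "cycle_walk G W \<longleftrightarrow> walk G W \<and> length W \<ge> 4 \<and> hd W = last W \<and> distinct (tl W)"

definition tree :: "'a ugraph \<Rightarrow> bool" where
  "tree G \<longleftrightarrow> simple_graph G \<and> connected_graph G \<and> \<not> (\<exists>W. cycle_walk G W)"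

definition line_graph :: "'a ugraph \<Rightarrow> 'a set ugraph" where
  "line_graph G = \<lparr>verts = edges G,
     edges = {{e, f} | e f. e \<in> edges G \<and> f \<in> edges G \<and> e \<noteq> f \<and> e \<inter> f \<noteq> {}}\<rparr>"

text \<open>The pair \<open>(u, v)\<close> in \<open>arcs\<close> is the arc with tail \<open>u\<close> and head \<open>v\<close>.\<close>

record 'a mixed_graph =
  mverts :: "'a set"
  digons :: "'a set set"
  arcs :: "('a \<times> 'a) set"

definition underlying :: "'a mixed_graph \<Rightarrow> 'a ugraph" where
  "underlying D = \<lparr>verts = mverts D, edges = digons D \<union> {{u, v} | u v. (u, v) \<in> arcs D}\<rparr>"

text \<open>
  The last two conditions say that each edge of the underlying graph is either left
  unoriented or given exactly one of its two orientations.
\<close>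

definition mixed_graph :: "'a mixed_graph \<Rightarrow> bool" where
  "mixed_graph D \<longleftrightarrow> simple_graph (underlying D) \<and>
     (\<forall>u v. (u, v) \<in> arcs D \<longrightarrow> {u, v} \<notin> digons D) \<and>
     (\<forall>u v. (u, v) \<in> arcs D \<longrightarrow> (v, u) \<notin> arcs D)"

definition gam :: complex where
  "gam = exp (2 * of_real pi * \<i> / 3)"

definition herm_adj :: "'a mixed_graph \<Rightarrow> 'a \<Rightarrow> 'a \<Rightarrow> complex" where
  "herm_adj D u v =
     (if {u, v} \<in> digons D then 1
      else if (u, v) \<in> arcs D then gam
      else if (v, u) \<in> arcs D then cnj gam
      else 0)"

definition walk_value :: "'a mixed_graph \<Rightarrow> 'a list \<Rightarrow> complex" where
  "walk_value D W = (\<Prod>i<length W - 1. herm_adj D (W ! i) (W ! Suc i))"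

definition gamma_monograph :: "'a mixed_graph \<Rightarrow> bool" where
  "gamma_monograph D \<longleftrightarrow> (\<forall>C. cycle_walk (underlying D) C \<longrightarrow> walk_value D C = 1)"

definition head_at :: "'a mixed_graph \<Rightarrow> 'a set \<Rightarrow> 'a \<Rightarrow> bool" where
  "head_at D e v \<longleftrightarrow> (\<exists>u. (u, v) \<in> arcs D \<and> e = {u, v})"

definition tail_at :: "'a mixed_graph \<Rightarrow> 'a set \<Rightarrow> 'a \<Rightarrow> bool" where
  "tail_at D e v \<longleftrightarrow> (\<exists>u. (v, u) \<in> arcs D \<and> e = {v, u})"

definition gamma_line_graph :: "'a mixed_graph \<Rightarrow> 'a set mixed_graph" where
  "gamma_line_graph D = \<lparr>
     mverts = edges (underlying D),
     digons = {{e, f} | e f. e \<noteq> f \<and> (\<exists>v \<in> e \<inter> f.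
         head_at D e v \<and> head_at D f v \<or>
         tail_at D e v \<and> tail_at D f v \<or>
         e \<in> digons D \<and> f \<in> digons D)},
     arcs = {(e, f). e \<noteq> f \<and> (\<exists>v \<in> e \<inter> f.
         head_at D e v \<and> tail_at D f v \<or>
         e \<in> digons D \<and> head_at D f v \<or>
         tail_at D e v \<and> f \<in> digons D)}\<rparr>"

end

theory Submission
  imports Defs
begin

text \<open>
  Write the nonzero entries of the Hermitian adjacency matrix of \<open>Y\<close> as \<open>\<gamma>\<^sup>h\<close> with
  \<open>h \<in> {0, 1, -1}\<close>. The edges of \<open>T\<close> at a vertex \<open>v\<close> form a clique of \<open>L(T)\<close>, so the monograph
  condition on triangles yields \<open>h(e, f) \<equiv> \<phi>\<^sub>v(f) - \<phi>\<^sub>v(e)\<close> modulo 3. On the other hand, in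
  \<open>L\<^sub>\<gamma>(X)\<close> one has \<open>h(e, f) \<equiv> s(f, v) - s(e, v)\<close>, where \<open>s(e, v)\<close> is \<open>1\<close>, \<open>-1\<close> or \<open>0\<close> when \<open>e\<close> has
  head \<open>v\<close>, has tail \<open>v\<close> or is a digon; a function \<open>s\<close> comes from some \<open>X\<close> as soon as
  \<open>s(e, u) + s(e, v) \<equiv> 0\<close> for every edge \<open>e = uv\<close>. Since each \<open>\<phi>\<^sub>v\<close> matters only up to a constant,
  we look for \<open>s(e, v) = \<phi>\<^sub>v(e) + c(v)\<close>, i.e. for \<open>c\<close> with prescribed sums \<open>c(u) + c(v)\<close> along the
  edges, and such a \<open>c\<close> is obtained by growing a subtree of \<open>T\<close> vertex by vertex.
\<close>

section \<open>Growing a subtree of a tree\<close>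

definition joined_within :: "'a ugraph \<Rightarrow> 'a set \<Rightarrow> bool" where
  "joined_within G S \<longleftrightarrow> (\<forall>x\<in>S. \<forall>y\<in>S. \<exists>P. walk G P \<and> set P \<subseteq> S \<and> distinct P \<and> hd P = x \<and> last P = y)"

lemma walk_exits:
  assumes "walk G W" "hd W \<in> S" "last W \<notin> S"
  shows "\<exists>u v. u \<in> S \<and> v \<in> verts G - S \<and> {u, v} \<in> edges G"
  using assms
proof (induction W)
  case Nil
  then show ?case by (simp add: walk_def)
next
  case (Cons x W)
  then have "W \<noteq> []" by auto
  then obtain y W' where W: "W = y # W'" by (cases W) auto
  show ?case
  proof (cases "y \<in> S")
    case True
    with Cons W show ?thesis by (auto simp: walk_def)
  next
    case False
    with Cons.prems W show ?thesis by (auto simp: walk_def)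
  qed
qed

lemma joined_within_insert:
  assumes j: "joined_within G S" and u: "u \<in> S" and v: "v \<in> verts G - S" and e: "{u, v} \<in> edges G"
  shows "joined_within G (insert v S)"
  unfolding joined_within_def
proof (intro ballI)
  have to_v: "\<exists>P. walk G P \<and> set P \<subseteq> insert v S \<and> distinct P \<and> hd P = x \<and> last P = v"
    and from_v: "\<exists>P. walk G P \<and> set P \<subseteq> insert v S \<and> distinct P \<and> hd P = v \<and> last P = x"
    if x: "x \<in> S" for x
  proof -
    obtain P where "walk G P" "set P \<subseteq> S" "distinct P" "hd P = x" "last P = u"
      using j x u unfolding joined_within_def by blast
    then have "walk G (P @ [v]) \<and> set (P @ [v]) \<subseteq> insert v S \<and> distinct (P @ [v])
        \<and> hd (P @ [v]) = x \<and> last (P @ [v]) = v"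
      using v e by (auto simp: walk_def successively_append_iff)
    then show "\<exists>P. walk G P \<and> set P \<subseteq> insert v S \<and> distinct P \<and> hd P = x \<and> last P = v" by blast
    obtain P where "walk G P" "set P \<subseteq> S" "distinct P" "hd P = u" "last P = x"
      using j x u unfolding joined_within_def by blast
    then have "walk G (v # P) \<and> set (v # P) \<subseteq> insert v S \<and> distinct (v # P)
        \<and> hd (v # P) = v \<and> last (v # P) = x"
      using v e by (auto simp: walk_def successively_Cons insert_commute)
    then show "\<exists>P. walk G P \<and> set P \<subseteq> insert v S \<and> distinct P \<and> hd P = v \<and> last P = x" by blast
  qed
  have vv: "\<exists>P. walk G P \<and> set P \<subseteq> insert v S \<and> distinct P \<and> hd P = v \<and> last P = v"
    using v by (intro exI[of _ "[v]"]) (auto simp: walk_def)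
  fix x y assume "x \<in> insert v S" "y \<in> insert v S"
  then show "\<exists>P. walk G P \<and> set P \<subseteq> insert v S \<and> distinct P \<and> hd P = x \<and> last P = y"
    using to_v from_v vv j unfolding joined_within_def by (metis insert_iff subset_insertI2)
qed

text \<open>Two neighbours of \<open>v\<close> in \<open>S\<close> would be the ends of a path
  inside \<open>S\<close>, and \<open>v\<close> lies outside \<open>S\<close>, so the path closes up
  through \<open>v\<close> to a cycle. Since \<open>u'\<close> and \<open>u\<close> differ, the path
  has at least two vertices, which gives the closed walk the required length of at least 4.\<close>

lemma acyclic_unique_neighbour:
  assumes j: "joined_within G S" and acyc: "\<not> (\<exists>W. cycle_walk G W)"
    and v: "v \<in> verts G - S" and u: "u \<in> S" "{u, v} \<in> edges G" and u': "u' \<in> S" "{u', v} \<in> edges G"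
  shows "u' = u"
proof (rule ccontr)
  assume ne: "u' \<noteq> u"
  obtain P where P: "walk G P" "set P \<subseteq> S" "distinct P" "hd P = u'" "last P = u"
    using j u u' unfolding joined_within_def by blast
  then obtain a b Q where Q: "P = a # b # Q"
    using ne by (cases P; cases "tl P") (auto simp: walk_def)
  have "cycle_walk G (v # P @ [v])"
    using P v u u' unfolding cycle_walk_def Q
    by (cases Q rule: rev_cases)
      (auto simp: walk_def successively_Cons successively_append_iff insert_commute hd_append)
  with acyc show False by blast
qed

lemma tree_edge_sums:
  fixes w :: "'a set \<Rightarrow> 'b::ab_group_add"
  assumes T: "tree T"
  shows "\<exists>c. \<forall>u v. {u, v} \<in> edges T \<longrightarrow> c u + c v = w {u, v}"
proof -
  \<comment> \<open>A maximal \<open>ok\<close> set replaces an induction over the tree: one exists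
    because \<open>verts T\<close> is finite, and it can be enlarged unless it contains every
    vertex.\<close>
  define ok where "ok S \<longleftrightarrow> S \<subseteq> verts T \<and> S \<noteq> {} \<and> joined_within T S \<and>
    (\<exists>c. \<forall>u\<in>S. \<forall>v\<in>S. {u, v} \<in> edges T \<longrightarrow> c u + c v = w {u, v})" for S
  have fin: "finite (verts T)" and edge: "\<And>e. e \<in> edges T \<Longrightarrow> e \<subseteq> verts T \<and> card e = 2"
    and acyc: "\<not> (\<exists>W. cycle_walk T W)" and conn: "connected_graph T"
    using T by (auto simp: tree_def simple_graph_def)
  have loop: "{x, x} \<notin> edges T" for x using edge by fastforce
  obtain r where r: "r \<in> verts T" using conn by (auto simp: connected_graph_def)
  have "walk T [r]" using r by (simp add: walk_def)
  then have "joined_within T {r}"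
    unfolding joined_within_def by (auto intro!: exI[of _ "[r]"])
  then have ok_r: "ok {r}" using r loop by (auto simp: ok_def)
  have "finite {S. ok S}" by (rule finite_subset[of _ "Pow (verts T)"]) (use fin in \<open>auto simp: ok_def\<close>)
  then obtain S where "ok S" and max: "\<And>S'. ok S' \<Longrightarrow> S \<subseteq> S' \<Longrightarrow> S = S'"
    using finite_has_maximal[of "{S. ok S}"] ok_r by auto
  then have S: "S \<subseteq> verts T" "S \<noteq> {}" "joined_within T S"
      "\<exists>c. \<forall>u\<in>S. \<forall>v\<in>S. {u, v} \<in> edges T \<longrightarrow> c u + c v = w {u, v}"
    by (simp_all add: ok_def)
  have "verts T \<subseteq> S"
  proof (rule ccontr)
    assume "\<not> verts T \<subseteq> S"
    then obtain x y where "x \<in> verts T - S" "y \<in> S" using S by blast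
    with conn S obtain W where "walk T W" "hd W = y" "last W = x"
      unfolding connected_graph_def by blast
    with \<open>x \<in> _\<close> \<open>y \<in> S\<close> obtain u v where uv: "u \<in> S" "v \<in> verts T - S" "{u, v} \<in> edges T"
      using walk_exits[of T W S] by blast
    obtain c where c: "\<forall>u\<in>S. \<forall>v\<in>S. {u, v} \<in> edges T \<longrightarrow> c u + c v = w {u, v}" using S by blast
    \<comment> \<open>The edge from \<open>u\<close> forces this value at \<open>v\<close>; by
      \<open>uniq\<close> no other edge joins \<open>v\<close> to \<open>S\<close>, so no further
      constraint arises.\<close>
    define c' where "c' = c(v := w {u, v} - c u)"
    have uniq: "u' = u" if "u' \<in> S" "{u', v} \<in> edges T" for u'
      using acyclic_unique_neighbour[of T S v u u'] S acyc uv that by blast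
    have "c' x + c' y = w {x, y}" if xy: "x \<in> insert v S" "y \<in> insert v S" "{x, y} \<in> edges T" for x y
    proof -
      consider "x = v" "y \<in> S" | "y = v" "x \<in> S" | "x \<in> S" "y \<in> S"
        using xy loop by blast
      then show ?thesis
      proof cases
        case 1
        then have "y = u" using uniq that by (simp add: insert_commute)
        with 1 uv show ?thesis by (auto simp: c'_def insert_commute)
      next
        case 2
        then have "x = u" using uniq that by simp
        with 2 uv show ?thesis by (auto simp: c'_def)
      next
        case 3
        then show ?thesis using c that uv by (auto simp: c'_def)
      qed
    qed
    then have "ok (insert v S)" using joined_within_insert[of T S u v] S uv unfolding ok_def by blast
    with max uv show False by blast
  qed
  with S obtain c where c: "\<forall>u\<in>verts T. \<forall>v\<in>verts T. {u, v} \<in> edges T \<longrightarrow> c u + c v = w {u, v}"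
    by blast
  then show ?thesis using edge by (meson insert_subset)
qed

section \<open>Exponents of Hermitian entries modulo 3\<close>

lemma int_neg_mod_3:
  fixes a b :: int
  assumes "a + b = 0"
  shows "b mod 3 = 1 \<longleftrightarrow> a mod 3 = 2" and "b mod 3 = 0 \<longleftrightarrow> a mod 3 = 0"
  using assms by presburger+

text \<open>On adjacent pairs this is the exponent of \<open>gam\<close> in \<open>herm_adj\<close>.
  It is 0 on non-adjacent pairs as well, so the value 0 identifies a digon only when the pair is
  known to be an edge.\<close>

definition herm_exp :: "'a mixed_graph \<Rightarrow> 'a \<Rightarrow> 'a \<Rightarrow> int" where
  "herm_exp D u v =
     (if {u, v} \<in> digons D then 0
      else if (u, v) \<in> arcs D then 1
      else if (v, u) \<in> arcs D then - 1
      else 0)"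

lemma gam_eq: "gam = Complex (- 1 / 2) (sqrt 3 / 2)"
proof -
  have "gam = cis (2 * pi / 3)" by (simp add: gam_def cis_conv_exp mult.commute)
  then show ?thesis
    by (simp add: cis.ctr cos_120 sin_120)
qed

text \<open>The product being 1 excludes zero entries, so each factor is 1, \<open>gam\<close> or
  \<open>cnj gam\<close>; the finitely many cases are decided by the explicit coordinates of
  \<open>gam\<close>.\<close>

lemma herm_exp_triangle:
  assumes "herm_adj D x y * herm_adj D y z * herm_adj D z x = 1"
  shows "(herm_exp D x y + herm_exp D y z + herm_exp D z x) mod 3 = 0"
  using assms unfolding herm_adj_def herm_exp_def
  by (auto simp: gam_eq complex_eq_iff split: if_splits)

lemma herm_exp_skew:
  assumes "mixed_graph D"
  shows "herm_exp D v u = - herm_exp D u v"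
  using assms by (auto simp: herm_exp_def mixed_graph_def insert_commute)

lemma digons_iff_herm_exp:
  assumes "{u, v} \<in> edges (underlying D)"
  shows "{u, v} \<in> digons D \<longleftrightarrow> herm_exp D u v = 0"
  using assms by (auto simp: herm_exp_def underlying_def doubleton_eq_iff)

lemma arcs_iff_herm_exp:
  assumes "mixed_graph D"
  shows "(u, v) \<in> arcs D \<longleftrightarrow> herm_exp D u v = 1"
  using assms by (auto simp: herm_exp_def mixed_graph_def)

lemma monograph_triangle:
  assumes "gamma_monograph D" and "{x, y, z} \<subseteq> verts (underlying D)" and "distinct [x, y, z]"
    and "{x, y} \<in> edges (underlying D)" "{y, z} \<in> edges (underlying D)" "{z, x} \<in> edges (underlying D)"
  shows "(herm_exp D x y + herm_exp D y z + herm_exp D z x) mod 3 = 0"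
proof (rule herm_exp_triangle)
  have "cycle_walk (underlying D) [x, y, z, x]"
    using assms by (auto simp: cycle_walk_def walk_def)
  then have "walk_value D [x, y, z, x] = 1" using assms(1) by (simp add: gamma_monograph_def)
  then show "herm_adj D x y * herm_adj D y z * herm_adj D z x = 1"
    by (simp add: walk_value_def lessThan_Suc eval_nat_numeral mult_ac)
qed

section \<open>From the monograph condition to a labelling of vertex-edge incidences\<close>

lemma star_potential:
  assumes Y: "mixed_graph Y" "gamma_monograph Y" and L: "underlying Y = line_graph T"
  shows "\<exists>p. \<forall>e\<in>edges T. \<forall>f\<in>edges T. e \<noteq> f \<longrightarrow> v \<in> e \<inter> f \<longrightarrow> herm_exp Y e f mod 3 = (p f - p e) mod 3"
proof (cases "\<exists>b\<in>edges T. v \<in> b")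
  case True
  then obtain b where b: "b \<in> edges T" "v \<in> b" by blast
  \<comment> \<open>The potential of an edge is its exponent relative to the base edge
    \<open>b\<close>, with value 0 at \<open>b\<close> itself. For \<open>e\<close> and
    \<open>f\<close> other than \<open>b\<close>, the three edges share \<open>v\<close> and form a
    triangle of the line graph.\<close>
  have "herm_exp Y e f mod 3
      = ((if f = b then 0 else herm_exp Y b f) - (if e = b then 0 else herm_exp Y b e)) mod 3"
    if e: "e \<in> edges T" "f \<in> edges T" "e \<noteq> f" "v \<in> e \<inter> f" for e f
  proof (cases "e = b \<or> f = b")
    case True
    then show ?thesis using e herm_exp_skew[OF Y(1), of b e] by auto
  next
    case False
    have "(herm_exp Y b e + herm_exp Y e f + herm_exp Y f b) mod 3 = 0"
      by (rule monograph_triangle[OF Y(2)]) (use b e False in \<open>auto simp: L line_graph_def\<close>)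
    then show ?thesis using False herm_exp_skew[OF Y(1), of b f] by simp presburger
  qed
  then show ?thesis by (intro exI[of _ "\<lambda>f. if f = b then 0 else herm_exp Y b f"]) blast
qed auto

lemma vertex_edge_labelling:
  assumes "mixed_graph Y" "gamma_monograph Y" "tree T" "underlying Y = line_graph T"
  obtains s :: "'a set \<Rightarrow> 'a \<Rightarrow> int"
  where "\<And>u v. {u, v} \<in> edges T \<Longrightarrow> s {u, v} u + s {u, v} v = 0"
    and "\<And>e f v. e \<in> edges T \<Longrightarrow> f \<in> edges T \<Longrightarrow> v \<in> e \<inter> f \<Longrightarrow> e \<noteq> f
      \<Longrightarrow> herm_exp Y e f mod 3 = (s f v - s e v) mod 3"
proof -
  have "\<exists>p. \<forall>v. \<forall>e\<in>edges T. \<forall>f\<in>edges T. e \<noteq> f \<longrightarrow> v \<in> e \<inter> f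
      \<longrightarrow> herm_exp Y e f mod 3 = (p v f - p v e) mod 3"
    by (intro choice allI star_potential assms)
  then obtain p where p: "\<forall>v. \<forall>e\<in>edges T. \<forall>f\<in>edges T. e \<noteq> f \<longrightarrow> v \<in> e \<inter> f
      \<longrightarrow> herm_exp Y e f mod 3 = (p v f - p v e) mod 3" by blast
  \<comment> \<open>The weight must depend on the edge as a set, hence the sum over its elements. It
    has two terms because the ends are distinct, as \<open>ne\<close> records.\<close>
  obtain c where c: "\<And>u v. {u, v} \<in> edges T \<Longrightarrow> c u + c v = - (\<Sum>x\<in>{u, v}. p x {u, v})"
    using tree_edge_sums[OF assms(3), of "\<lambda>e. - (\<Sum>x\<in>e. p x e)"] by blast
  have ne: "u \<noteq> v" if "{u, v} \<in> edges T" for u v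
    using that assms(3) by (fastforce simp: tree_def simple_graph_def)
  show thesis
  \<comment> \<open>The shift \<open>c v\<close> cancels in differences at \<open>v\<close>, while
    its sum over the two ends of an edge cancels the sum of the potentials there.\<close>
  proof (rule that[of "\<lambda>e v. p v e + c v"])
    show "(p u {u, v} + c u) + (p v {u, v} + c v) = 0" if "{u, v} \<in> edges T" for u v
      using c[OF that] ne[OF that] by simp
    show "herm_exp Y e f mod 3 = ((p v f + c v) - (p v e + c v)) mod 3"
      if "e \<in> edges T" "f \<in> edges T" "v \<in> e \<inter> f" "e \<noteq> f" for e f v
      using p that by simp
  qed
qed

section \<open>The mixed graph defined by a labelling\<close>

text \<open>Residue 1 at an end means head, 2 means tail and 0 means digon. Only heads are tested
  for arcs: when the labels of an edge sum to 0, residue 1 at one end forces residue 2 at the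
  other.\<close>

definition mixed_of_labelling :: "'a ugraph \<Rightarrow> ('a set \<Rightarrow> 'a \<Rightarrow> int) \<Rightarrow> 'a mixed_graph" where
  "mixed_of_labelling G s = \<lparr>mverts = verts G,
     digons = {e \<in> edges G. \<forall>v\<in>e. s e v mod 3 = 0},
     arcs = {(u, v). {u, v} \<in> edges G \<and> s {u, v} v mod 3 = 1}\<rparr>"

context
  fixes G :: "'a ugraph" and s :: "'a set \<Rightarrow> 'a \<Rightarrow> int"
  assumes simple: "simple_graph G"
    and antisym: "\<And>u v. {u, v} \<in> edges G \<Longrightarrow> s {u, v} u + s {u, v} v = 0"
begin

lemma edge_obtain_other_end:
  assumes "e \<in> edges G" "v \<in> e"
  obtains u where "e = {u, v}" "u \<noteq> v"
proof -
  have "card e = 2" using assms simple by (auto simp: simple_graph_def)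
  then show ?thesis using assms that by (auto simp: card_2_iff)
qed

lemma head_at_mixed_of_labelling:
  "head_at (mixed_of_labelling G s) e v \<longleftrightarrow> e \<in> edges G \<and> v \<in> e \<and> s e v mod 3 = 1"
proof
  assume "e \<in> edges G \<and> v \<in> e \<and> s e v mod 3 = 1"
  then show "head_at (mixed_of_labelling G s) e v"
    using edge_obtain_other_end[of e v]
    by (auto simp: head_at_def mixed_of_labelling_def)
qed (auto simp: head_at_def mixed_of_labelling_def)

lemma tail_at_mixed_of_labelling:
  "tail_at (mixed_of_labelling G s) e v \<longleftrightarrow> e \<in> edges G \<and> v \<in> e \<and> s e v mod 3 = 2"
proof
  assume e: "e \<in> edges G \<and> v \<in> e \<and> s e v mod 3 = 2"
  then obtain u where u: "e = {v, u}" using edge_obtain_other_end[of e v] by (metis insert_commute)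
  then have "s e u mod 3 = 1" using int_neg_mod_3(1)[OF antisym[of v u]] e by simp
  then show "tail_at (mixed_of_labelling G s) e v"
    using e u by (auto simp: tail_at_def mixed_of_labelling_def)
next
  assume "tail_at (mixed_of_labelling G s) e v"
  then obtain u where u: "e = {v, u}" "e \<in> edges G" "s e u mod 3 = 1"
    by (auto simp: tail_at_def mixed_of_labelling_def)
  then have "s e v mod 3 = 2" using int_neg_mod_3(1)[OF antisym[of v u]] by simp
  with u show "e \<in> edges G \<and> v \<in> e \<and> s e v mod 3 = 2" by blast
qed

lemma digons_mixed_of_labelling:
  assumes "v \<in> e"
  shows "e \<in> digons (mixed_of_labelling G s) \<longleftrightarrow> e \<in> edges G \<and> s e v mod 3 = 0"
proof
  assume e: "e \<in> edges G \<and> s e v mod 3 = 0"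
  then obtain u where u: "e = {u, v}" using edge_obtain_other_end[of e v] assms by metis
  then have "s e u mod 3 = 0" using int_neg_mod_3(2)[OF antisym[of u v]] e by (simp add: insert_commute)
  with e u show "e \<in> digons (mixed_of_labelling G s)" by (auto simp: mixed_of_labelling_def)
qed (use assms in \<open>auto simp: mixed_of_labelling_def\<close>)

lemma underlying_mixed_of_labelling: "underlying (mixed_of_labelling G s) = G"
proof -
  let ?X = "mixed_of_labelling G s"
  have "e \<in> digons ?X \<union> {{u, v} | u v. (u, v) \<in> arcs ?X}" if e: "e \<in> edges G" for e
  proof -
    have "card e = 2" using e simple by (auto simp: simple_graph_def)
    then obtain u v where uv: "e = {u, v}" by (auto simp: card_2_iff)
    have "s e v mod 3 = 0 \<or> s e v mod 3 = 1 \<or> s e v mod 3 = 2" by presburger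
    then consider "e \<in> digons ?X" | "head_at ?X e v" | "tail_at ?X e v"
      using e uv digons_mixed_of_labelling[of v e] head_at_mixed_of_labelling
        tail_at_mixed_of_labelling by auto
    then show ?thesis by cases (auto simp: head_at_def tail_at_def)
  qed
  then have "digons ?X \<union> {{u, v} | u v. (u, v) \<in> arcs ?X} = edges G"
    by (auto simp: mixed_of_labelling_def)
  then show ?thesis by (simp add: underlying_def mixed_of_labelling_def)
qed

lemma mixed_graph_mixed_of_labelling: "mixed_graph (mixed_of_labelling G s)"
  unfolding mixed_graph_def
proof (intro conjI allI impI)
  fix u v assume "(u, v) \<in> arcs (mixed_of_labelling G s)"
  then have uv: "{u, v} \<in> edges G" "s {u, v} v mod 3 = 1"
    by (auto simp: mixed_of_labelling_def)
  then show "{u, v} \<notin> digons (mixed_of_labelling G s)" by (auto simp: mixed_of_labelling_def)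
  have "s {u, v} u mod 3 \<noteq> 1" using uv int_neg_mod_3(1)[OF antisym[of u v]] by auto
  then show "(v, u) \<notin> arcs (mixed_of_labelling G s)"
    by (auto simp: mixed_of_labelling_def insert_commute)
qed (simp add: underlying_mixed_of_labelling simple)

text \<open>At a common vertex, the cases defining the \<gamma>-line graph depend only on the
  difference of the two residues: 0 gives a digon, 1 an arc from \<open>e\<close> to
  \<open>f\<close>.\<close>

lemma gamma_line_graph_mixed_of_labelling:
  assumes Y: "mixed_graph Y" and L: "underlying Y = line_graph G"
    and h: "\<And>e f v. e \<in> edges G \<Longrightarrow> f \<in> edges G \<Longrightarrow> v \<in> e \<inter> f \<Longrightarrow> e \<noteq> f
      \<Longrightarrow> herm_exp Y e f mod 3 = (s f v - s e v) mod 3"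
  shows "gamma_line_graph (mixed_of_labelling G s) = Y"
proof -
  let ?X = "mixed_of_labelling G s"
  note at_simps = head_at_mixed_of_labelling tail_at_mixed_of_labelling
  \<comment> \<open>The values -1, 0, 1 are distinct modulo 3, so congruences for
    \<open>herm_exp\<close> become equalities.\<close>
  have range: "herm_exp Y e f \<in> {- 1, 0, 1}" for e f by (auto simp: herm_exp_def)
  have ledge: "{e, f} \<in> edges (underlying Y) \<longleftrightarrow> e \<in> edges G \<and> f \<in> edges G \<and> e \<noteq> f \<and> e \<inter> f \<noteq> {}"
    for e f by (auto simp: L line_graph_def doubleton_eq_iff)
  have digon_iff: "(head_at ?X e v \<and> head_at ?X f v \<or> tail_at ?X e v \<and> tail_at ?X f v
        \<or> e \<in> digons ?X \<and> f \<in> digons ?X)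
      \<longleftrightarrow> e \<in> edges G \<and> f \<in> edges G \<and> {e, f} \<in> digons Y" (is "?l \<longleftrightarrow> ?r")
    if v: "v \<in> e \<inter> f" "e \<noteq> f" for e f v
  proof (cases "e \<in> edges G \<and> f \<in> edges G")
    case True
    have "?l \<longleftrightarrow> s e v mod 3 = s f v mod 3"
      using True v digons_mixed_of_labelling[of v] by (simp add: at_simps) presburger
    also have "\<dots> \<longleftrightarrow> herm_exp Y e f = 0"
      using h[of e f v] True v range[of e f] by simp presburger
    also have "\<dots> \<longleftrightarrow> {e, f} \<in> digons Y"
      using digons_iff_herm_exp[of e f Y] ledge True v by blast
    finally show ?thesis using True by blast
  next
    case False
    then show ?thesis using v digons_mixed_of_labelling[of v] by (auto simp: at_simps)
  qed
  have arc_iff: "(head_at ?X e v \<and> tail_at ?X f v \<or> e \<in> digons ?X \<and> head_at ?X f v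
        \<or> tail_at ?X e v \<and> f \<in> digons ?X)
      \<longleftrightarrow> e \<in> edges G \<and> f \<in> edges G \<and> (e, f) \<in> arcs Y" (is "?l \<longleftrightarrow> ?r")
    if v: "v \<in> e \<inter> f" "e \<noteq> f" for e f v
  proof (cases "e \<in> edges G \<and> f \<in> edges G")
    case True
    \<comment> \<open>The three alternatives are the residue pairs (1, 2), (0, 1) and (2, 0) at
      \<open>e\<close> and \<open>f\<close>, exactly those with difference 1 modulo 3.\<close>
    have "?l \<longleftrightarrow> (s f v - s e v) mod 3 = 1"
      using True v digons_mixed_of_labelling[of v] by (simp add: at_simps) presburger
    also have "\<dots> \<longleftrightarrow> herm_exp Y e f = 1"
      using h[of e f v] True v range[of e f] by simp presburger
    also have "\<dots> \<longleftrightarrow> (e, f) \<in> arcs Y"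
      using arcs_iff_herm_exp[OF Y] by blast
    finally show ?thesis using True by blast
  next
    case False
    then show ?thesis using v digons_mixed_of_labelling[of v] by (auto simp: at_simps)
  qed
  \<comment> \<open>The right side of \<open>digon_iff\<close> does not mention \<open>v\<close>, so
    every common vertex gives the same answer and the existential reduces to \<open>e\<close> and
    \<open>f\<close> meeting.\<close>
  have "(e \<noteq> f \<and> (\<exists>v\<in>e \<inter> f. head_at ?X e v \<and> head_at ?X f v \<or> tail_at ?X e v \<and> tail_at ?X f v
        \<or> e \<in> digons ?X \<and> f \<in> digons ?X))
      \<longleftrightarrow> {e, f} \<in> edges (underlying Y) \<and> {e, f} \<in> digons Y" for e f
    unfolding ledge using digon_iff[of _ e f] by (metis (no_types, lifting) ex_in_conv)
  then have "digons (gamma_line_graph ?X) = {{e, f} | e f. {e, f} \<in> edges (underlying Y) \<and> {e, f} \<in> digons Y}"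
    by (simp only: gamma_line_graph_def mixed_graph.simps)
  also have "\<dots> = digons Y"
  proof -
    have *: "\<exists>e f. d = {e, f}" if "d \<in> digons Y" for d
    proof -
      have "card d = 2" using that Y by (auto simp: mixed_graph_def simple_graph_def underlying_def)
      then show ?thesis by (auto simp: card_2_iff)
    qed
    have "d \<in> {{e, f} | e f. {e, f} \<in> edges (underlying Y) \<and> {e, f} \<in> digons Y}"
      if "d \<in> digons Y" for d
    proof -
      obtain e f where "d = {e, f}" using \<open>d \<in> digons Y\<close> * by blast
      then show ?thesis using \<open>d \<in> digons Y\<close> by (auto simp: underlying_def)
    qed
    then show ?thesis by blast
  qed
  finally have digons: "digons (gamma_line_graph ?X) = digons Y" .
  have "(e \<noteq> f \<and> (\<exists>v\<in>e \<inter> f. head_at ?X e v \<and> tail_at ?X f v \<or> e \<in> digons ?X \<and> head_at ?X f v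
        \<or> tail_at ?X e v \<and> f \<in> digons ?X))
      \<longleftrightarrow> {e, f} \<in> edges (underlying Y) \<and> (e, f) \<in> arcs Y" for e f
    unfolding ledge using arc_iff[of _ e f] by (metis (no_types, lifting) ex_in_conv)
  then have "arcs (gamma_line_graph ?X) = {(e, f). {e, f} \<in> edges (underlying Y) \<and> (e, f) \<in> arcs Y}"
    by (simp only: gamma_line_graph_def mixed_graph.simps)
  also have "\<dots> = arcs Y" by (auto simp: underlying_def)
  finally have arcs: "arcs (gamma_line_graph ?X) = arcs Y" .
  have "mverts (gamma_line_graph ?X) = edges G"
    by (simp add: gamma_line_graph_def underlying_mixed_of_labelling)
  also have "\<dots> = mverts Y" using L by (simp add: underlying_def line_graph_def)
  finally show ?thesis using digons arcs by simp
qed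

end

theorem theorem32:
  fixes Y :: "'a set mixed_graph" and T :: "'a ugraph"
  assumes "mixed_graph Y"
    and "gamma_monograph Y"
    and "tree T"
    and "underlying Y = line_graph T"
  shows "\<exists>X :: 'a mixed_graph. mixed_graph X \<and> underlying X = T \<and> Y = gamma_line_graph X"
proof -
  obtain s :: "'a set \<Rightarrow> 'a \<Rightarrow> int"
    where anti: "\<And>u v. {u, v} \<in> edges T \<Longrightarrow> s {u, v} u + s {u, v} v = 0"
      and h: "\<And>e f v. e \<in> edges T \<Longrightarrow> f \<in> edges T \<Longrightarrow> v \<in> e \<inter> f \<Longrightarrow> e \<noteq> f
        \<Longrightarrow> herm_exp Y e f mod 3 = (s f v - s e v) mod 3"
    using vertex_edge_labelling[OF assms] by metis
  have simple: "simple_graph T" using assms(3) by (simp add: tree_def)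
  show ?thesis
  proof (intro exI conjI)
    show "mixed_graph (mixed_of_labelling T s)"
      using simple anti by (rule mixed_graph_mixed_of_labelling)
    show "underlying (mixed_of_labelling T s) = T"
      using simple anti by (rule underlying_mixed_of_labelling)
    show "Y = gamma_line_graph (mixed_of_labelling T s)"
      using simple anti assms(1,4) h by (rule gamma_line_graph_mixed_of_labelling[symmetric])
  qed
qed

end
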